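(* Let $n\ge3$. Let $U\subset\mathcal{S}^{n\times n}$ be an open set satisfying $O^{-1}UO=U$ for all $O\in O(n)$, and let $F\in C^1(U)$ satisfy $F(O^{-1}MO)=F(M)$ for all $M\in U$, $O\in O(n)$, and be such that the matrix $(F_{ij}(M))$ is positive definite for all $M\in U$. Assume that $u\in C^2(B_1)$ is radially symmetric and satisfies $$F(A^u)=1,\quad A^u\in U,\quad u>0,\quad\text{in }B_1.$$ Then $u$ is of the form $$u(x)\equiv\Big(\frac{a}{1+b|x|^2}\Big)^{\frac{n-2}{2}}\quad\text{in }B_1,$$ with $a>0$, $b\ge-1$, $\frac{2b}{a^2}I\in U$ and $F\big(\frac{2b}{a^2}I\big)=1$.
   Context: $\mathcal{S}^{n\times n}$ is the set of $n\times n$ real symmetric matrices, $O(n)$ the set of $n\times n$ real orthogonal matrices, $F_{ij}(M):=\frac{\partial F}{\partial M_{ij}}(M)$, and $B_1$ is the open unit ball in $\mathbb{R}^n$ centered at the origin. For a positive $C^2$ function $u$, $$A^u:=-\frac{2}{n-2}u^{-\frac{n+2}{n-2}}\nabla^2u+\frac{2n}{(n-2)^2}u^{-\frac{2n}{n-2}}\nabla u\otimes\nabla u-\frac{2}{(n-2)^2}u^{-\frac{2n}{n-2}}|\nabla u|^2I,$$ where $I$ is the $n\times n$ identity matrix. *)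

theory Defs
  imports "HOL-Analysis.Analysis"
begin

definition sym_matrices :: "(real^'n^'n) set" where
  "sym_matrices = {M. transpose M = M}"

definition positive_definite :: "real^'n^'n \<Rightarrow> bool" where
  "positive_definite M \<longleftrightarrow> transpose M = M \<and> (\<forall>v. v \<noteq> 0 \<longrightarrow> v \<bullet> (M *v v) > 0)"

definition dir_deriv :: "('a::real_normed_vector \<Rightarrow> real) \<Rightarrow> 'a \<Rightarrow> 'a \<Rightarrow> real" where
  "dir_deriv f v x = deriv (\<lambda>t. f (x + t *\<^sub>R v)) 0"

text \<open>
  Continuous differentiability on a relatively open subset \<open>S\<close> of a linear subspace \<open>V\<close>. Only
  directions in \<open>V\<close> are used, so the values of \<open>f\<close> off \<open>S\<close> are irrelevant.
\<close>

definition C1_on :: "'a::real_normed_vector set \<Rightarrow> 'a set \<Rightarrow> ('a \<Rightarrow> real) \<Rightarrow> bool" where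
  "C1_on V S f \<longleftrightarrow> f differentiable_on S \<and> (\<forall>v\<in>V. continuous_on S (dir_deriv f v))"

definition C2_on :: "'a::real_normed_vector set \<Rightarrow> 'a set \<Rightarrow> ('a \<Rightarrow> real) \<Rightarrow> bool" where
  "C2_on V S f \<longleftrightarrow> C1_on V S f \<and> (\<forall>v\<in>V. C1_on V S (dir_deriv f v))"

text \<open>
  The matrix \<open>(F\<^sub>i\<^sub>j(M))\<close> of a function of symmetric matrices. Since \<open>M + t E\<^sub>i\<^sub>j\<close> is
  not symmetric for \<open>i \<noteq> j\<close>, the derivative is taken along \<open>(E\<^sub>i\<^sub>j + E\<^sub>j\<^sub>i) / 2\<close>. This is the usual
  convention, under which \<open>dF(M)(H) = \<Sum>\<^sub>i\<^sub>j F\<^sub>i\<^sub>j(M) H\<^sub>i\<^sub>j\<close> for all symmetric \<open>H\<close>; it agrees with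
  \<open>\<partial>F/\<partial>M\<^sub>i\<^sub>j\<close> for the extension \<open>M \<mapsto> F ((M + M\<^sup>T) / 2)\<close> of \<open>F\<close> to nonsymmetric matrices.
\<close>

definition sym_unit :: "'n \<Rightarrow> 'n \<Rightarrow> real^'n^'n" where
  "sym_unit i j = (1/2) *\<^sub>R (axis i (axis j 1) + axis j (axis i 1))"

definition matrix_gradient :: "(real^'n^'n \<Rightarrow> real) \<Rightarrow> real^'n^'n \<Rightarrow> real^'n^'n" where
  "matrix_gradient F M = (\<chi> i j. dir_deriv F (sym_unit i j) M)"

definition grad :: "(real^'n \<Rightarrow> real) \<Rightarrow> real^'n \<Rightarrow> real^'n" where
  "grad u x = (\<chi> i. dir_deriv u (axis i 1) x)"

definition hessian :: "(real^'n \<Rightarrow> real) \<Rightarrow> real^'n \<Rightarrow> real^'n^'n" where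
  "hessian u x = (\<chi> i j. dir_deriv (dir_deriv u (axis j 1)) (axis i 1) x)"

definition outer :: "real^'n \<Rightarrow> real^'n \<Rightarrow> real^'n^'n" where
  "outer v w = (\<chi> i j. v $ i * w $ j)"

definition conf_hessian :: "(real^'n \<Rightarrow> real) \<Rightarrow> real^'n \<Rightarrow> real^'n^'n" where
  "conf_hessian u x =
     (let n = real CARD('n) in
        (- (2 / (n - 2)) * u x powr (- ((n + 2) / (n - 2)))) *\<^sub>R hessian u x
      + (2 * n / (n - 2)\<^sup>2 * u x powr (- (2 * n / (n - 2)))) *\<^sub>R outer (grad u x) (grad u x)
      - (2 / (n - 2)\<^sup>2 * u x powr (- (2 * n / (n - 2))) * (norm (grad u x))\<^sup>2) *\<^sub>R mat 1)"

definition radially_symmetric_on :: "'a::real_normed_vector set \<Rightarrow> ('a \<Rightarrow> real) \<Rightarrow> bool" where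
  "radially_symmetric_on S u \<longleftrightarrow> (\<exists>\<phi>. \<forall>x\<in>S. u x = \<phi> (norm x))"

end

theory Submission
  imports Defs
begin

text \<open>
  In terms of \<open>w = u powr (-2/(n-2))\<close> the matrix \<open>A\<^sup>u\<close> is \<open>w \<nabla>\<^sup>2w - |\<nabla>w|\<^sup>2/2 I\<close>. For radial \<open>u\<close> it is
  therefore diagonal in an orthonormal basis that contains the radial direction, with eigenvalue
  \<open>p = w w'' - w'\<^sup>2/2\<close> in that direction and \<open>q = w w'/r - w'\<^sup>2/2\<close> in the tangential ones. The claim
  is that \<open>p = q\<close> everywhere: then \<open>w'/r\<close> is constant, \<open>w\<close> is a quadratic polynomial
  \<open>(1 + b r\<^sup>2)/a\<close>, and \<open>p = q = 2b/a\<^sup>2\<close>.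
  
  Two facts give \<open>p = q\<close>. One is the identity \<open>q' = (p - q) (1/r - w'/w)\<close>, in which no third
  derivative of \<open>w\<close> occurs. The other comes from ellipticity: both eigenvalues equal
  \<open>l = w(0) w''(0)\<close> at the origin, and near \<open>l I\<close> the level set of \<open>F\<close> among the diagonal
  matrices in question is the graph of a decreasing function, \<open>p - l = -c (q - l)\<close> with
  \<open>0 \<le> c \<le> C\<close> (lemma \<open>radial_level_set\<close>). Together they give
  \<open>q' = -(1 + c) (1/r - w'/w) (q - l)\<close> as long as \<open>p\<close> and \<open>q\<close> stay close to \<open>l\<close>.
  
  Near \<open>r = 0\<close> the factor \<open>1/r - w'/w\<close> is unbounded but positive, so \<open>(q - l)\<^sup>2\<close> cannot increase
  from its value \<open>0\<close> at the origin. Near any \<open>r > 0\<close> the factor is bounded, and a Gronwall argument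
  propagates \<open>q = l\<close> to both sides. Hence the set where \<open>p = q = l\<close> is open and closed in \<open>[0,1)\<close>
  (lemma \<open>radial_ode_rigidity\<close>). Finally \<open>b \<ge> -1\<close>, as otherwise \<open>w\<close> would vanish inside the ball.
\<close>

section \<open>Derivatives along lines\<close>

text \<open>
  Differentiability within a set that contains a piece of a line already determines the derivative
  along that line. Allowing \<open>S\<close> to be a set without interior covers functions of symmetric matrices,
  which are differentiable only within the symmetric matrices.
\<close>

lemma line_derivative:
  fixes f :: "'a::real_normed_vector \<Rightarrow> real"
  assumes f': "(f has_derivative f') (at (x + t *\<^sub>R v) within S)"
    and near: "\<forall>\<^sub>F s in nhds t. x + s *\<^sub>R v \<in> S"
  shows "((\<lambda>s. f (x + s *\<^sub>R v)) has_real_derivative f' v) (at t)"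
    and "dir_deriv f v (x + t *\<^sub>R v) = f' v"
proof -
  have line: "((\<lambda>s. f (y + s *\<^sub>R v)) has_real_derivative f' v) (at r)"
    if y: "y + r *\<^sub>R v = x + t *\<^sub>R v" and ev: "\<forall>\<^sub>F s in nhds r. y + s *\<^sub>R v \<in> S" for y r
  proof -
    obtain T where T: "open T" "r \<in> T" "\<And>s. s \<in> T \<Longrightarrow> y + s *\<^sub>R v \<in> S"
      using ev unfolding eventually_nhds by blast
    have g: "((\<lambda>s. y + s *\<^sub>R v) has_derivative (\<lambda>h. h *\<^sub>R v)) (at r within T)"
      by (auto intro!: derivative_eq_intros)
    have "(f has_derivative f') (at (y + r *\<^sub>R v) within (\<lambda>s. y + s *\<^sub>R v) ` T)"
      using f' y T(3) by (auto intro: has_derivative_subset)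
    from diff_chain_within[OF g this]
    have "((\<lambda>s. f (y + s *\<^sub>R v)) has_derivative (\<lambda>h. f' (h *\<^sub>R v))) (at r within T)"
      by (simp add: o_def)
    moreover have "(\<lambda>h. f' (h *\<^sub>R v)) = (*) (f' v)"
      using linear_scale[OF has_derivative_linear[OF f']] by (simp add: fun_eq_iff)
    ultimately show ?thesis
      using at_within_open[OF T(2,1)] by (simp only: has_field_derivative_def)
  qed
  show "((\<lambda>s. f (x + s *\<^sub>R v)) has_real_derivative f' v) (at t)"
    by (rule line[OF refl near])
  obtain T where T: "open T" "t \<in> T" "\<And>s. s \<in> T \<Longrightarrow> x + s *\<^sub>R v \<in> S"
    using near unfolding eventually_nhds by blast
  have "open ((\<lambda>s. s + t) -` T)" "0 \<in> (\<lambda>s. s + t) -` T"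
    using T by (auto intro!: continuous_open_vimage continuous_intros)
  moreover have "\<And>s. s \<in> (\<lambda>s. s + t) -` T \<Longrightarrow> x + t *\<^sub>R v + s *\<^sub>R v \<in> S"
    using T(3)[of "_ + t"] by (simp add: algebra_simps)
  ultimately have "\<forall>\<^sub>F s in nhds 0. x + t *\<^sub>R v + s *\<^sub>R v \<in> S"
    unfolding eventually_nhds by blast
  from line[OF _ this] show "dir_deriv f v (x + t *\<^sub>R v) = f' v"
    unfolding dir_deriv_def by (intro DERIV_imp_deriv) simp
qed

lemma line_derivative_open:
  fixes f :: "'a::real_normed_vector \<Rightarrow> real"
  assumes "f differentiable_on S" "open S" "x + t *\<^sub>R v \<in> S"
  shows "((\<lambda>s. f (x + s *\<^sub>R v)) has_real_derivative dir_deriv f v (x + t *\<^sub>R v)) (at t)"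
proof -
  obtain f' where f': "(f has_derivative f') (at (x + t *\<^sub>R v) within S)"
    using assms by (auto simp: differentiable_on_def differentiable_def)
  have "open ((\<lambda>s. x + s *\<^sub>R v) -` S)"
    by (intro continuous_open_vimage assms continuous_intros)
  then have "\<forall>\<^sub>F s in nhds t. x + s *\<^sub>R v \<in> S"
    using assms(3) unfolding eventually_nhds by blast
  from line_derivative[OF f' this] show ?thesis by simp
qed

lemma DERIV_eventually_eq:
  fixes f g :: "real \<Rightarrow> real"
  assumes "(f has_real_derivative D) (at x)" "\<forall>\<^sub>F t in nhds x. g t = f t"
  shows "(g has_real_derivative D) (at x)"
  using DERIV_cong_ev[OF refl assms(2) refl] assms(1) by simp

lemma even_derivative_zero:
  fixes f :: "real \<Rightarrow> real"
  assumes d: "(f has_real_derivative d) (at 0)" and e: "\<forall>\<^sub>F t in nhds 0. f (- t) = f t"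
  shows "d = 0"
proof -
  have "((\<lambda>t. - t) has_real_derivative - 1) (at (0::real))"
    by (rule DERIV_minus[OF DERIV_ident])
  from DERIV_chain2[OF _ this, of f d] d
  have "((\<lambda>t. f (- t)) has_real_derivative - d) (at 0)" by simp
  then have "(f has_real_derivative - d) (at 0)"
    using DERIV_cong_ev[OF refl e refl] by blast
  with d have "d = - d" by (rule DERIV_unique)
  then show ?thesis by simp
qed

section \<open>The Hessian of a radial function\<close>

definition radial_matrix :: "'n \<Rightarrow> real \<Rightarrow> real \<Rightarrow> real^'n^'n" where
  "radial_matrix k p q = (\<chi> i j. if i = j then if i = k then p else q else 0)"

lemma norm_axis_pair:
  assumes "i \<noteq> k"
  shows "norm (a *\<^sub>R axis k (1::real) + b *\<^sub>R axis i 1) = sqrt (a\<^sup>2 + b\<^sup>2)"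
proof -
  have "norm (a *\<^sub>R axis k (1::real) + b *\<^sub>R axis i 1) ^ 2 = a\<^sup>2 + b\<^sup>2"
    using assms unfolding power2_norm_eq_inner
    by (simp add: inner_add_left inner_add_right inner_axis_axis power2_eq_square)
  then show ?thesis by (metis norm_ge_zero real_sqrt_unique)
qed

lemma norm_reflect:
  fixes x :: "real^'n"
  assumes "x $ j = 0"
  shows "norm (x + (- s) *\<^sub>R axis j 1) = norm (x + s *\<^sub>R axis j 1)"
  using assms
  by (simp add: norm_eq_sqrt_inner inner_add_left inner_add_right inner_diff_left inner_diff_right inner_axis inner_axis' inner_axis_axis)

text \<open>
  Every mixed entry of the Hessian on the \<open>k\<close>-axis, and every non-radial entry of the gradient, vanishes
  by parity: reflecting a coordinate that vanishes at the given point does not change the norm, so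
  \<open>u\<close> is even in that coordinate. The tangential entries \<open>v'(r)/r\<close> come from
  \<open>u(r e\<^sub>k + t e\<^sub>i) = v(sqrt(r\<^sup>2 + t\<^sup>2))\<close> when \<open>r > 0\<close>; at the origin this formula is singular, and the
  entries are \<open>v''(0)\<close> because all coordinate axes see the same profile. The profile \<open>v\<close> is taken along
  the whole axis, negative \<open>r\<close> included, so that it is twice differentiable at \<open>0\<close>.
\<close>

lemma radial_C2_profile:
  fixes u :: "real^'n \<Rightarrow> real" and k :: 'n
  assumes C2: "C2_on UNIV (ball 0 1) u" and rad: "radially_symmetric_on (ball 0 1) u"
  obtains v v1 v2 where
    "\<And>x. x \<in> ball 0 1 \<Longrightarrow> u x = v (norm x)"
    "\<And>r. v r = u (r *\<^sub>R axis k 1)"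
    "\<And>r. \<bar>r\<bar> < 1 \<Longrightarrow> (v has_real_derivative v1 r) (at r)"
    "\<And>r. \<bar>r\<bar> < 1 \<Longrightarrow> (v1 has_real_derivative v2 r) (at r)"
    "continuous_on {-1<..<1} v2"
    "v1 0 = 0"
    "\<And>r. 0 \<le> r \<Longrightarrow> r < 1 \<Longrightarrow> grad u (r *\<^sub>R axis k 1) = v1 r *\<^sub>R axis k 1"
    "\<And>r. 0 \<le> r \<Longrightarrow> r < 1 \<Longrightarrow> hessian u (r *\<^sub>R axis k 1)
        = radial_matrix k (v2 r) (if r = 0 then v2 0 else v1 r / r)"
proof -
  let ?B = "ball (0::real^'n) 1"
  let ?D = "\<lambda>i. dir_deriv u (axis i 1)"
  define v where "v r = u (r *\<^sub>R axis k 1)" for r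
  define v1 where "v1 r = ?D k (r *\<^sub>R axis k 1)" for r
  define v2 where "v2 r = dir_deriv (?D k) (axis k 1) (r *\<^sub>R axis k 1)" for r
  have du: "u differentiable_on ?B" and dDu: "?D i differentiable_on ?B"
    and cDD: "continuous_on ?B (dir_deriv (?D i) (axis j 1))" for i j
    using C2 by (auto simp: C2_on_def C1_on_def)
  have eq: "u x = u y" if "norm x = norm y" "norm x < 1" for x y
    using rad that unfolding radially_symmetric_on_def by force
  have near: "\<forall>\<^sub>F s in nhds 0. norm (x + s *\<^sub>R y) < 1" if "norm x < 1" for x y :: "real^'n"
  proof -
    have "open ((\<lambda>s. norm (x + s *\<^sub>R y)) -` {..<1})"
      by (intro continuous_open_vimage continuous_intros open_lessThan)
    then show ?thesis using that unfolding eventually_nhds by fastforce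
  qed
  have uv: "u x = v (norm x)" if "x \<in> ?B" for x
    unfolding v_def using that by (intro eq) auto
  have dv: "(v has_real_derivative v1 r) (at r)" if "\<bar>r\<bar> < 1" for r
    using line_derivative_open[OF du open_ball, of 0 r "axis k 1"] that
    by (simp add: v_def[abs_def] v1_def)
  have dv1: "(v1 has_real_derivative v2 r) (at r)" if "\<bar>r\<bar> < 1" for r
    using line_derivative_open[OF dDu open_ball, of 0 r "axis k 1" k] that
    by (simp add: v2_def v1_def[abs_def])
  have cv2: "continuous_on {-1<..<1} v2"
    unfolding v2_def[abs_def]
    by (rule continuous_on_compose2[OF cDD]) (auto intro!: continuous_intros)
  have D0: "?D j x = 0" if "norm x < 1" "x $ j = 0" for j x
  proof (rule even_derivative_zero)
    show "((\<lambda>s. u (x + s *\<^sub>R axis j 1)) has_real_derivative ?D j x) (at 0)"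
      using line_derivative_open[OF du open_ball, of x 0 "axis j 1"] that by simp
    show "\<forall>\<^sub>F s in nhds 0. u (x + (- s) *\<^sub>R axis j 1) = u (x + s *\<^sub>R axis j 1)"
      using near[OF that(1), of "axis j 1"]
      by eventually_elim (metis eq norm_reflect that(2))
  qed
  have v10: "v1 0 = 0"
    using D0[of 0 k] by (simp add: v1_def)
  have DD: "((\<lambda>t. ?D j (x + t *\<^sub>R axis i 1)) has_real_derivative
      dir_deriv (?D j) (axis i 1) x) (at 0)" if "norm x < 1" for i j x
    using line_derivative_open[OF dDu open_ball, of x 0 "axis i 1" j] that by simp
  have off: "dir_deriv (?D j) (axis i 1) (r *\<^sub>R axis k 1) = 0"
    if r: "0 \<le> r" "r < 1" and ij: "i \<noteq> j" for r i j
  proof (cases "j = k")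
    case False
    \<comment> \<open>Along this line the \<open>j\<close>-th coordinate is \<open>0\<close>, so the partial derivative vanishes identically.\<close>
    have "\<forall>\<^sub>F t in nhds 0. ?D j (r *\<^sub>R axis k 1 + t *\<^sub>R axis i 1) = 0"
    proof (rule eventually_mono[OF near[of "r *\<^sub>R axis k 1" "axis i 1"]])
      show "norm (r *\<^sub>R axis k (1::real)) < 1" using r by simp
    qed (rule D0, use ij False in \<open>auto simp: axis_def\<close>)
    then have "((\<lambda>t. 0) has_real_derivative dir_deriv (?D j) (axis i 1) (r *\<^sub>R axis k 1)) (at 0)"
      using DD[of "r *\<^sub>R axis k 1" j i] r DERIV_cong_ev[OF refl] by fastforce
    then show ?thesis by (metis DERIV_const DERIV_unique)
  next
    case True
    \<comment> \<open>Here the partial derivative is not zero, but it is even in the coordinate \<open>i\<close>.\<close>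
    show ?thesis
    proof (rule even_derivative_zero)
      show "((\<lambda>t. ?D j (r *\<^sub>R axis k 1 + t *\<^sub>R axis i 1)) has_real_derivative
        dir_deriv (?D j) (axis i 1) (r *\<^sub>R axis k 1)) (at 0)"
        using DD r by simp
      have "?D j (r *\<^sub>R axis k 1 + (- t) *\<^sub>R axis i 1) = ?D j (r *\<^sub>R axis k 1 + t *\<^sub>R axis i 1)"
        if t: "norm (r *\<^sub>R axis k 1 + t *\<^sub>R axis i 1 :: real^'n) < 1" for t
        unfolding dir_deriv_def
      proof (rule deriv_cong_ev[OF _ refl])
        show "\<forall>\<^sub>F s in nhds 0. u (r *\<^sub>R axis k 1 + (- t) *\<^sub>R axis i 1 + s *\<^sub>R axis j 1)
          = u (r *\<^sub>R axis k 1 + t *\<^sub>R axis i 1 + s *\<^sub>R axis j 1)"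
          using near[OF t, of "axis j 1"]
        proof eventually_elim
          case (elim s)
          have "norm ((r *\<^sub>R axis k 1 + s *\<^sub>R axis j 1) + (- t) *\<^sub>R axis i (1::real))
            = norm ((r *\<^sub>R axis k 1 + s *\<^sub>R axis j 1) + t *\<^sub>R axis i (1::real))"
            by (rule norm_reflect) (use True ij in \<open>auto simp: axis_def\<close>)
          then have "norm (r *\<^sub>R axis k 1 + (- t) *\<^sub>R axis i 1 + s *\<^sub>R axis j (1::real))
            = norm (r *\<^sub>R axis k 1 + t *\<^sub>R axis i 1 + s *\<^sub>R axis j (1::real))"
            by (simp add: algebra_simps)
          then show ?case using elim eq by metis
        qed
      qed
      then show "\<forall>\<^sub>F t in nhds 0. ?D j (r *\<^sub>R axis k 1 + (- t) *\<^sub>R axis i 1)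
          = ?D j (r *\<^sub>R axis k 1 + t *\<^sub>R axis i 1)"
        using near[of "r *\<^sub>R axis k 1" "axis i 1"] r by (auto elim!: eventually_mono)
    qed
  qed
  have diag0: "dir_deriv (?D i) (axis i 1) 0 = v2 0" for i
  proof -
    have Dv: "?D i (t *\<^sub>R axis i 1) = v1 t" if t: "norm (t *\<^sub>R axis i (1::real)) < 1" for t
      unfolding v1_def dir_deriv_def
    proof (rule deriv_cong_ev[OF _ refl])
      show "\<forall>\<^sub>F s in nhds 0. u (t *\<^sub>R axis i 1 + s *\<^sub>R axis i 1)
          = u (t *\<^sub>R axis k 1 + s *\<^sub>R axis k 1)"
        using near[OF t, of "axis i 1"]
        by eventually_elim (rule eq, simp_all flip: scaleR_add_left)
    qed
    have "\<forall>\<^sub>F t in nhds 0. ?D i (0 + t *\<^sub>R axis i 1) = v1 t"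
      using near[of 0 "axis i 1"] by (auto elim!: eventually_mono simp: Dv)
    then have "(v1 has_real_derivative dir_deriv (?D i) (axis i 1) 0) (at 0)"
      using DD[of 0 i i] DERIV_cong_ev[OF refl] by fastforce
    with dv1[of 0] show ?thesis by (auto intro: DERIV_unique)
  qed
  have diag: "dir_deriv (?D i) (axis i 1) (r *\<^sub>R axis k 1) = v1 r / r"
    if r: "0 < r" "r < 1" and ik: "i \<noteq> k" for r i
  proof -
    define \<rho> where "\<rho> t = sqrt (r\<^sup>2 + t\<^sup>2)" for t
    have \<rho>pos: "\<rho> t > 0" for t using r by (simp add: \<rho>_def add_pos_nonneg)
    have d\<rho>: "(\<rho> has_real_derivative t / \<rho> t) (at t)" for t
    proof -
      have "0 < r\<^sup>2 + t\<^sup>2" using r by (simp add: add_pos_nonneg)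
      then show ?thesis
        unfolding \<rho>_def[abs_def] by (auto intro!: derivative_eq_intros simp: field_simps)
    qed
    have Dt: "?D i (r *\<^sub>R axis k 1 + t *\<^sub>R axis i 1) = v1 (\<rho> t) * (t / \<rho> t)"
      if t: "norm (r *\<^sub>R axis k 1 + t *\<^sub>R axis i (1::real)) < 1" for t
    proof -
      have nt: "norm (r *\<^sub>R axis k 1 + s *\<^sub>R axis i (1::real)) = \<rho> s" for s
        using norm_axis_pair[OF ik] by (simp add: \<rho>_def)
      have lt: "\<rho> t < 1" using t nt by simp
      have "((\<lambda>s. u (r *\<^sub>R axis k 1 + s *\<^sub>R axis i 1)) has_real_derivative
          ?D i (r *\<^sub>R axis k 1 + t *\<^sub>R axis i 1)) (at t)"
        using line_derivative_open[OF du open_ball, of "r *\<^sub>R axis k 1" t "axis i 1"] t by simp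
      moreover have "\<forall>\<^sub>F s in nhds t. u (r *\<^sub>R axis k 1 + s *\<^sub>R axis i 1) = v (\<rho> s)"
      proof -
        have "open (\<rho> -` {..<1})"
          unfolding \<rho>_def[abs_def] by (intro continuous_open_vimage continuous_intros open_lessThan)
        moreover have "t \<in> \<rho> -` {..<1}" using lt by simp
        moreover have "\<And>s. s \<in> \<rho> -` {..<1} \<Longrightarrow> u (r *\<^sub>R axis k 1 + s *\<^sub>R axis i 1) = v (\<rho> s)"
          using uv nt by simp
        ultimately show ?thesis unfolding eventually_nhds by blast
      qed
      ultimately have "((\<lambda>s. v (\<rho> s)) has_real_derivative
          ?D i (r *\<^sub>R axis k 1 + t *\<^sub>R axis i 1)) (at t)"
        using DERIV_cong_ev[OF refl] by fastforce
      moreover have "((\<lambda>s. v (\<rho> s)) has_real_derivative v1 (\<rho> t) * (t / \<rho> t)) (at t)"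
        using DERIV_chain2[OF dv d\<rho>, of t] lt \<rho>pos[of t] by simp
      ultimately show ?thesis by (rule DERIV_unique)
    qed
    have "\<forall>\<^sub>F t in nhds 0. ?D i (r *\<^sub>R axis k 1 + t *\<^sub>R axis i 1) = v1 (\<rho> t) * (t / \<rho> t)"
      using near[of "r *\<^sub>R axis k 1" "axis i 1"] r by (auto elim!: eventually_mono simp: Dt)
    then have "((\<lambda>t. v1 (\<rho> t) * (t / \<rho> t)) has_real_derivative
        dir_deriv (?D i) (axis i 1) (r *\<^sub>R axis k 1)) (at 0)"
      using DD[of "r *\<^sub>R axis k 1" i i] r DERIV_cong_ev[OF refl] by fastforce
    moreover have "\<rho> 0 = r" using r by (simp add: \<rho>_def)
    then have "((\<lambda>t. v1 (\<rho> t) * (t / \<rho> t)) has_real_derivative v1 r / r) (at 0)"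
      using r by (auto intro!: derivative_eq_intros DERIV_chain2[OF dv1 d\<rho>] d\<rho> simp: field_simps)
    ultimately show ?thesis by (rule DERIV_unique)
  qed
  have g: "grad u (r *\<^sub>R axis k 1) = v1 r *\<^sub>R axis k 1" if "0 \<le> r" "r < 1" for r
  proof -
    have "?D i (r *\<^sub>R axis k 1) = 0" if "i \<noteq> k" for i
      by (rule D0) (use \<open>0 \<le> r\<close> \<open>r < 1\<close> that in simp, use that in \<open>simp add: axis_def\<close>)
    then have "?D i (r *\<^sub>R axis k 1) = v1 r * axis k 1 $ i" for i
      by (cases "i = k") (simp_all add: v1_def, simp add: axis_def)
    then show ?thesis
      by (simp add: vec_eq_iff grad_def)
  qed
  have h: "hessian u (r *\<^sub>R axis k 1) = radial_matrix k (v2 r) (if r = 0 then v2 0 else v1 r / r)"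
    if "0 \<le> r" "r < 1" for r
    using that off[of r] diag0 diag[of r]
    by (auto simp: vec_eq_iff hessian_def radial_matrix_def v2_def)
  show thesis by (rule that[OF uv v_def dv dv1 cv2 v10 g h])
qed

section \<open>Level sets of elliptic functions near multiples of the identity\<close>

lemma radial_matrix_eq_sum:
  "radial_matrix k p q = (\<Sum>i\<in>UNIV. (if i = k then p else q) *\<^sub>R sym_unit i i)"
proof -
  have "(if i = k then p else q) * sym_unit i i $ a $ b
      = (if i = a then if a = b then if a = k then p else q else 0 else 0)" for i a b
    by (auto simp: sym_unit_def axis_def)
  then show ?thesis by (simp add: vec_eq_iff radial_matrix_def)
qed

lemma radial_matrix_sym: "radial_matrix k p q \<in> sym_matrices"
  by (auto simp: sym_matrices_def radial_matrix_def transpose_def vec_eq_iff)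

lemma subspace_sym_matrices: "subspace (sym_matrices :: (real^'n^'n) set)"
  by (auto simp: subspace_def sym_matrices_def transpose_def vec_eq_iff)

lemma sym_unit_sym: "sym_unit i j \<in> sym_matrices"
  by (auto simp: sym_matrices_def sym_unit_def transpose_def vec_eq_iff axis_def)

lemma positive_definite_diag_pos:
  assumes "positive_definite M"
  shows "0 < M $ i $ i"
proof -
  have "0 < axis i 1 \<bullet> (M *v axis i 1)"
    using assms by (auto simp: positive_definite_def)
  then show ?thesis
    by (simp add: matrix_vector_mul_component inner_axis' inner_axis)
qed

text \<open>
  By the mean value theorem along the segment from \<open>l0 I\<close>,
  \<open>0 = (p - l0) F\<^sub>k\<^sub>k + (q - l0) (\<Sum>i\<noteq>k. F\<^sub>i\<^sub>i)\<close> at an intermediate matrix, and all \<open>F\<^sub>i\<^sub>i\<close> are positive by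
  ellipticity. So \<open>c\<close> is the quotient of the two coefficients, which continuity bounds near \<open>l0 I\<close>.
  This replaces the implicit function theorem.
\<close>

lemma radial_level_set:
  fixes F :: "real^'n^'n \<Rightarrow> real"
  assumes U_open: "openin (top_of_set sym_matrices) U"
    and C1: "C1_on sym_matrices U F"
    and ell: "\<And>M. M \<in> U \<Longrightarrow> positive_definite (matrix_gradient F M)"
    and l0: "radial_matrix k l0 l0 \<in> U"
  obtains \<delta> C where "0 < \<delta>"
    "\<And>p q. \<bar>p - l0\<bar> < \<delta> \<Longrightarrow> \<bar>q - l0\<bar> < \<delta> \<Longrightarrow> F (radial_matrix k p q) = F (radial_matrix k l0 l0) \<Longrightarrow>
      \<exists>c. 0 \<le> c \<and> c \<le> C \<and> p - l0 = - c * (q - l0)"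
proof -
  define M0 where "M0 = radial_matrix k l0 l0"
  define g where "g i = dir_deriv F (sym_unit i i)" for i
  have gpos: "0 < g i M" if "M \<in> U" for i M
    using positive_definite_diag_pos[OF ell[OF that], of i] by (simp add: matrix_gradient_def g_def)
  have cg: "continuous_on U (g i)" for i
    unfolding g_def using C1 sym_unit_sym by (auto simp: C1_on_def)
  obtain e where e: "e > 0" "\<And>M. M \<in> sym_matrices \<Longrightarrow> dist M M0 < e \<Longrightarrow> M \<in> U"
    using U_open l0 unfolding openin_euclidean_subtopology_iff M0_def by blast
  define S where "S = (\<Sum>i\<in>UNIV - {k}. g i M0) + 1"
  have cS: "continuous_on U (\<lambda>M. \<Sum>i\<in>UNIV - {k}. g i M)"
    by (intro continuous_intros cg)
  have evU: "\<forall>\<^sub>F M in at M0 within U. g k M > g k M0 / 2 \<and> (\<Sum>i\<in>UNIV - {k}. g i M) < S"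
    using cg[of k] cS l0 gpos[of M0 k]
    unfolding continuous_on_def M0_def[symmetric]
    by (intro eventually_conj order_tendstoD[where F="at M0 within U"]) (auto simp: S_def)
  obtain d where d: "d > 0" "\<And>M. M \<in> U \<Longrightarrow> dist M M0 < d \<Longrightarrow>
      g k M > g k M0 / 2 \<and> (\<Sum>i\<in>UNIV - {k}. g i M) < S"
  proof -
    from evU obtain d where d: "d > 0" "\<And>M. M \<in> U \<Longrightarrow> M \<noteq> M0 \<Longrightarrow> dist M M0 < d \<Longrightarrow>
      g k M > g k M0 / 2 \<and> (\<Sum>i\<in>UNIV - {k}. g i M) < S"
      unfolding eventually_at by blast
    have "g k M0 > g k M0 / 2 \<and> (\<Sum>i\<in>UNIV - {k}. g i M0) < S"
      using gpos[of M0 k] l0 by (simp add: M0_def S_def)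
    with d show thesis by (intro that[of d]) metis+
  qed
  have "((\<lambda>x. radial_matrix k (fst x) (snd x)) \<longlongrightarrow> M0) (nhds (l0, l0))"
  proof -
    have "((\<lambda>x. if b then fst x else snd x) \<longlongrightarrow> l0) (nhds (l0, l0))" for b
      using tendsto_fst[OF filterlim_ident, of "(l0, l0)"] tendsto_snd[OF filterlim_ident, of "(l0, l0)"]
      by (cases b) simp_all
    then show ?thesis
      unfolding M0_def radial_matrix_def by (intro vec_tendstoI) simp
  qed
  then have "\<forall>\<^sub>F x in nhds (l0, l0). dist (radial_matrix k (fst x) (snd x)) M0 < min e d"
    using e(1) d(1) by (intro tendstoD) auto
  then obtain \<eta> where \<eta>: "\<eta> > 0" "\<And>x. dist x (l0, l0) < \<eta> \<Longrightarrow>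
      dist (radial_matrix k (fst x) (snd x)) M0 < min e d"
    unfolding eventually_nhds_metric by blast
  show thesis
  proof (rule that[of "\<eta> / 2" "S / (g k M0 / 2)"])
    show "0 < \<eta> / 2" using \<eta> by simp
    fix p q
    assume pq: "\<bar>p - l0\<bar> < \<eta> / 2" "\<bar>q - l0\<bar> < \<eta> / 2"
      and eq: "F (radial_matrix k p q) = F (radial_matrix k l0 l0)"
    define H where "H = radial_matrix k (p - l0) (q - l0)"
    have line: "M0 + t *\<^sub>R H = radial_matrix k (l0 + t * (p - l0)) (l0 + t * (q - l0))" for t
      by (simp add: M0_def H_def radial_matrix_def vec_eq_iff)
    have dpq: "dist (p, q) (l0, l0) < \<eta>"
    proof -
      have "dist (p, q) (l0, l0) \<le> \<bar>p - l0\<bar> + \<bar>q - l0\<bar>"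
        using sqrt_sum_squares_le_sum_abs[of "p - l0" "q - l0"] by (simp add: dist_Pair_Pair dist_real_def)
      then show ?thesis using pq by linarith
    qed
    have near1: "dist (M0 + 1 *\<^sub>R H) M0 < min e d"
      using \<eta>(2)[OF dpq] by (simp only: line) simp
    have near: "dist (M0 + t *\<^sub>R H) M0 < min e d" if "0 \<le> t" "t \<le> 1" for t
    proof -
      have "dist (M0 + t *\<^sub>R H) M0 \<le> dist (M0 + 1 *\<^sub>R H) M0"
        using that mult_left_le_one_le[of "norm H" t] by (simp add: dist_norm)
      then show ?thesis using near1 by linarith
    qed
    have inU: "M0 + t *\<^sub>R H \<in> U" if "0 \<le> t" "t \<le> 1" for t
      using e(2)[of "M0 + t *\<^sub>R H"] near[OF that] by (simp add: line radial_matrix_sym)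
    have deriv: "((\<lambda>s. F (M0 + s *\<^sub>R H)) has_real_derivative
        (p - l0) * g k (M0 + t *\<^sub>R H) + (q - l0) * (\<Sum>i\<in>UNIV - {k}. g i (M0 + t *\<^sub>R H))) (at t)"
      if t: "0 \<le> t" "t \<le> 1" for t
    proof -
      let ?M = "M0 + t *\<^sub>R H"
      obtain F' where F': "(F has_derivative F') (at ?M within U)"
        using C1 inU[OF t] by (auto simp: C1_on_def differentiable_on_def differentiable_def)
      have ev: "\<forall>\<^sub>F s in nhds r. N + s *\<^sub>R V \<in> U"
        if N: "N + r *\<^sub>R V = ?M" "N \<in> sym_matrices" "V \<in> sym_matrices" for N V r
      proof -
        obtain T where T: "open T" "U = sym_matrices \<inter> T" using U_open by (auto simp: openin_open)
        have "open ((\<lambda>s. N + s *\<^sub>R V) -` T)"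
          by (intro continuous_open_vimage T continuous_intros)
        moreover have "r \<in> (\<lambda>s. N + s *\<^sub>R V) -` T" using N(1) inU[OF t] T by auto
        moreover have "N + s *\<^sub>R V \<in> sym_matrices" for s
          using N subspace_sym_matrices by (auto intro: subspace_add subspace_scale)
        ultimately show ?thesis unfolding eventually_nhds T(2) by blast
      qed
      have sM: "M0 \<in> sym_matrices" "?M \<in> sym_matrices" "H \<in> sym_matrices"
        by (simp_all only: line) (simp_all add: M0_def H_def radial_matrix_sym)
      have gF': "g i ?M = F' (sym_unit i i)" for i
        using line_derivative(2)[of F F' ?M 0 "sym_unit i i" U] F'
          ev[of ?M 0 "sym_unit i i"] sM(2) by (simp add: g_def sym_unit_sym)
      have lin: "linear F'" using F' by (rule has_derivative_linear)
      have "F' H = (\<Sum>i\<in>UNIV. (if i = k then p - l0 else q - l0) * F' (sym_unit i i))"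
        unfolding H_def radial_matrix_eq_sum by (simp add: linear_sum[OF lin] linear_scale[OF lin])
      also have "\<dots> = (\<Sum>i\<in>UNIV. (if i = k then p - l0 else q - l0) * g i ?M)"
        by (simp add: gF')
      also have "\<dots> = (p - l0) * g k ?M + (q - l0) * (\<Sum>i\<in>UNIV - {k}. g i ?M)"
        by (subst sum.remove[of UNIV k]) (auto simp: sum_distrib_left intro: sum.cong)
      finally show ?thesis
        using line_derivative(1)[OF F' ev[OF refl sM(1,3)]] by simp
    qed
    obtain t where t: "0 < t" "t < 1" and "F (M0 + 1 *\<^sub>R H) - F (M0 + 0 *\<^sub>R H) =
        (1 - 0) * ((p - l0) * g k (M0 + t *\<^sub>R H) + (q - l0) * (\<Sum>i\<in>UNIV - {k}. g i (M0 + t *\<^sub>R H)))"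
      using MVT2[OF zero_less_one deriv] by blast
    moreover have "F (M0 + 1 *\<^sub>R H) = F (M0 + 0 *\<^sub>R H)"
      using eq by (simp only: line) (simp add: M0_def)
    ultimately have mv: "(p - l0) * g k (M0 + t *\<^sub>R H)
        + (q - l0) * (\<Sum>i\<in>UNIV - {k}. g i (M0 + t *\<^sub>R H)) = 0" by simp
    let ?M = "M0 + t *\<^sub>R H"
    let ?A = "\<Sum>i\<in>UNIV - {k}. g i ?M"
    have MU: "?M \<in> U" using inU t by simp
    have b: "g k ?M > g k M0 / 2" "?A < S" using d(2)[OF MU] near[of t] t by auto
    have g0: "0 < g k M0" using gpos l0 by (simp add: M0_def)
    have A0: "0 \<le> ?A" using gpos[OF MU] by (intro sum_nonneg) (simp add: less_imp_le)
    show "\<exists>c\<ge>0. c \<le> S / (g k M0 / 2) \<and> p - l0 = - c * (q - l0)"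
    proof (intro exI conjI)
      show "0 \<le> ?A / g k ?M" using A0 gpos[OF MU, of k] by simp
      show "?A / g k ?M \<le> S / (g k M0 / 2)" using A0 b g0 by (intro frac_le) auto
      show "p - l0 = - (?A / g k ?M) * (q - l0)"
        using mv gpos[OF MU, of k] by (simp add: field_simps)
    qed
  qed
qed

section \<open>The conformal Hessian of a radial function\<close>

text \<open>
  The quantities \<open>w1\<close> and \<open>w2\<close> are the first two derivatives of \<open>w = u powr -\<alpha>\<close> in the radial direction,
  and \<open>w1s\<close> is \<open>w'/r\<close> (its limit \<open>w''(0)\<close> at the origin). The exponent \<open>\<alpha> = 2/(n-2)\<close> is the one for
  which the conformal factor \<open>u powr (4/(n-2))\<close> is \<open>w\<^sup>-\<^sup>2\<close>; it turns \<open>A\<^sup>u\<close> into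
  \<open>w \<nabla>\<^sup>2w - |\<nabla>w|\<^sup>2/2 I\<close>.
\<close>

lemma conf_hessian_radial_matrix:
  fixes u :: "real^'n \<Rightarrow> real" and k :: 'n
  defines "\<alpha> \<equiv> 2 / (real CARD('n) - 2)"
  assumes n: "CARD('n) \<ge> 3"
    and g: "grad u x = v1 *\<^sub>R axis k 1"
    and h: "hessian u x = radial_matrix k v2 s"
  shows "conf_hessian u x =
    (let w = u x powr - \<alpha>; w1 = - \<alpha> * u x powr (- \<alpha> - 1) * v1;
         w2 = - \<alpha> * u x powr (- \<alpha> - 1) * v2 + \<alpha> * (\<alpha> + 1) * u x powr (- \<alpha> - 2) * v1\<^sup>2;
         w1s = - \<alpha> * u x powr (- \<alpha> - 1) * s
     in radial_matrix k (w * w2 - w1\<^sup>2 / 2) (w * w1s - w1\<^sup>2 / 2))"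
proof -
  let ?n = "real CARD('n)"
  have n2: "?n - 2 > 0" using n by linarith
  have e: "- ((?n + 2) / (?n - 2)) = - 2 * \<alpha> - 1" "- (2 * ?n / (?n - 2)) = - 2 * \<alpha> - 2"
    "2 / (?n - 2) = \<alpha>" "2 * ?n / (?n - 2)\<^sup>2 = \<alpha> * (\<alpha> + 1)" "2 / (?n - 2)\<^sup>2 = \<alpha>\<^sup>2 / 2"
    using n2 by (simp_all add: \<alpha>_def divide_simps power2_eq_square)
  have P: "u x powr - \<alpha> * u x powr (- \<alpha> - 1) = u x powr (- 2 * \<alpha> - 1)"
    "u x powr - \<alpha> * u x powr (- \<alpha> - 2) = u x powr (- 2 * \<alpha> - 2)"
    "(u x powr (- \<alpha> - 1))\<^sup>2 = u x powr (- 2 * \<alpha> - 2)"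
    by (simp_all add: powr_add[symmetric] power2_eq_square algebra_simps)
  have ng: "(norm (grad u x))\<^sup>2 = v1\<^sup>2" by (simp add: g norm_mult power_mult_distrib)
  have og: "outer (grad u x) (grad u x) = radial_matrix k (v1\<^sup>2) 0"
    by (simp add: g outer_def radial_matrix_def vec_eq_iff axis_def power2_eq_square)
  have "conf_hessian u x = radial_matrix k
      (- \<alpha> * u x powr (- 2 * \<alpha> - 1) * v2 + \<alpha> * (\<alpha> + 1) * u x powr (- 2 * \<alpha> - 2) * v1\<^sup>2
        - \<alpha>\<^sup>2 / 2 * u x powr (- 2 * \<alpha> - 2) * v1\<^sup>2)
      (- \<alpha> * u x powr (- 2 * \<alpha> - 1) * s - \<alpha>\<^sup>2 / 2 * u x powr (- 2 * \<alpha> - 2) * v1\<^sup>2)"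
    unfolding conf_hessian_def Let_def e ng og h
    by (simp add: radial_matrix_def vec_eq_iff mat_def)
  also have "\<dots> = (let w = u x powr - \<alpha>; w1 = - \<alpha> * u x powr (- \<alpha> - 1) * v1;
         w2 = - \<alpha> * u x powr (- \<alpha> - 1) * v2 + \<alpha> * (\<alpha> + 1) * u x powr (- \<alpha> - 2) * v1\<^sup>2;
         w1s = - \<alpha> * u x powr (- \<alpha> - 1) * s
     in radial_matrix k (w * w2 - w1\<^sup>2 / 2) (w * w1s - w1\<^sup>2 / 2))"
    unfolding Let_def P[symmetric]
    by (intro arg_cong2[where f="radial_matrix k"]) (simp_all add: algebra_simps power_mult_distrib P)
  finally show ?thesis .
qed

section \<open>Rigidity of the radial equation\<close>

text \<open>
  Gronwall in both directions: the bound makes \<open>f\<^sup>2 exp (-2 K t)\<close> nonincreasing and \<open>f\<^sup>2 exp (2 K t)\<close>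
  nondecreasing, and both vanish at \<open>s\<close>.
\<close>

lemma zero_of_linear_growth_bound:
  fixes f f' :: "real \<Rightarrow> real"
  assumes d: "\<And>r. a < r \<Longrightarrow> r < b \<Longrightarrow> (f has_real_derivative f' r) (at r)"
    and bd: "\<And>r. a < r \<Longrightarrow> r < b \<Longrightarrow> \<bar>f' r\<bar> \<le> K * \<bar>f r\<bar>"
    and s: "a < s" "s < b" "f s = 0" and r: "a < r" "r < b"
  shows "f r = 0"
proof -
  have ff: "\<bar>f t * f' t\<bar> \<le> K * (f t)\<^sup>2" if "a < t" "t < b" for t
    using mult_left_mono[OF bd[OF that], of "\<bar>f t\<bar>"]
    by (simp add: abs_mult power2_eq_square mult.left_commute)
  have E: "((\<lambda>t. (f t)\<^sup>2 * exp (c * t)) has_real_derivative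
      (2 * (f t * f' t) + c * (f t)\<^sup>2) * exp (c * t)) (at t)" if "a < t" "t < b" for c t
    using d[OF that] by (auto intro!: derivative_eq_intros simp: algebra_simps power2_eq_square)
  have "(f r)\<^sup>2 \<le> 0"
  proof (cases "s \<le> r")
    case True
    have "(f r)\<^sup>2 * exp (- 2 * K * r) \<le> (f s)\<^sup>2 * exp (- 2 * K * s)"
    proof (rule DERIV_nonpos_imp_nonincreasing[OF True])
      fix t assume "s \<le> t" "t \<le> r"
      then have t: "a < t" "t < b" using s r by auto
      have "2 * (f t * f' t) + (- 2 * K) * (f t)\<^sup>2 \<le> 0" using ff[OF t] by linarith
      then show "\<exists>y. ((\<lambda>t. (f t)\<^sup>2 * exp (- 2 * K * t)) has_real_derivative y) (at t) \<and> y \<le> 0"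
        using E[OF t, of "- 2 * K"] mult_nonpos_nonneg[of _ "exp (- 2 * K * t)"] exp_ge_zero by blast
    qed
    then show ?thesis using s(3) by (simp add: mult_le_0_iff)
  next
    case False
    have "(f r)\<^sup>2 * exp (2 * K * r) \<le> (f s)\<^sup>2 * exp (2 * K * s)"
    proof (rule DERIV_nonneg_imp_nondecreasing[of r s])
      show "r \<le> s" using False by simp
      fix t assume "r \<le> t" "t \<le> s"
      then have t: "a < t" "t < b" using s r by auto
      have "2 * (f t * f' t) + (2 * K) * (f t)\<^sup>2 \<ge> 0" using ff[OF t] by linarith
      then show "\<exists>y. ((\<lambda>t. (f t)\<^sup>2 * exp (2 * K * t)) has_real_derivative y) (at t) \<and> 0 \<le> y"
        using E[OF t, of "2 * K"] mult_nonneg_nonneg[of _ "exp (2 * K * t)"] exp_ge_zero by blast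
    qed
    then show ?thesis using s(3) by (simp add: mult_le_0_iff)
  qed
  then show ?thesis by simp
qed

text \<open>
  The quotient \<open>\<kappa> = w'/r\<close> extends continuously to the origin by \<open>w''(0)\<close>, so \<open>p\<close> and \<open>q\<close> are
  continuous on \<open>[0,1)\<close> and start from the common value \<open>l0\<close>. The set where both equal \<open>l0\<close> is closed.
  It is open because \<open>q' = (p - q) (1/r - w'/w)\<close> and \<open>level\<close> make \<open>q - l0\<close> satisfy a linear
  homogeneous equation, which is dissipative near \<open>0\<close> and has bounded coefficients away from \<open>0\<close>.
\<close>

lemma radial_ode_rigidity:
  fixes w w1 w2 :: "real \<Rightarrow> real" and l0 \<delta> C :: real
  defines "\<kappa> \<equiv> \<lambda>r. if r = 0 then w2 0 else w1 r / r"
  defines "p \<equiv> \<lambda>r. w r * w2 r - (w1 r)\<^sup>2 / 2"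
    and "q \<equiv> \<lambda>r. w r * \<kappa> r - (w1 r)\<^sup>2 / 2"
  assumes w: "\<And>r. \<bar>r\<bar> < 1 \<Longrightarrow> (w has_real_derivative w1 r) (at r)"
    and w1: "\<And>r. \<bar>r\<bar> < 1 \<Longrightarrow> (w1 has_real_derivative w2 r) (at r)"
    and w2: "continuous_on {-1<..<1} w2"
    and pos: "\<And>r. \<bar>r\<bar> < 1 \<Longrightarrow> 0 < w r"
    and w10: "w1 0 = 0"
    and l0: "l0 = w 0 * w2 0" and \<delta>: "0 < \<delta>"
    and level: "\<And>r. 0 \<le> r \<Longrightarrow> r < 1 \<Longrightarrow> \<bar>p r - l0\<bar> < \<delta> \<Longrightarrow> \<bar>q r - l0\<bar> < \<delta> \<Longrightarrow>
       \<exists>c. 0 \<le> c \<and> c \<le> C \<and> p r - l0 = - c * (q r - l0)"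
  obtains \<beta> where "\<And>r. 0 \<le> r \<Longrightarrow> r < 1 \<Longrightarrow> w r = w 0 + \<beta> * r\<^sup>2" "l0 = 2 * w 0 * \<beta>"
proof -
  have cw: "continuous_on {-1<..<1} w" and cw1: "continuous_on {-1<..<1} w1"
    by (intro continuous_at_imp_continuous_on ballI; rule DERIV_isCont[OF w] DERIV_isCont[OF w1]; force)+
  have c\<kappa>: "continuous_on {-1<..<1} \<kappa>"
  proof (intro continuous_at_imp_continuous_on ballI)
    fix r :: real assume r: "r \<in> {-1<..<1}"
    show "isCont \<kappa> r"
    proof (cases "r = 0")
      case True
      have "(\<lambda>h. (w1 (0 + h) - w1 0) / h) \<midarrow>0\<rightarrow> w2 0"
        using w1[of 0] by (simp only: DERIV_def abs_zero zero_less_one)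
      then have "(\<lambda>h. w1 h / h) \<midarrow>0\<rightarrow> w2 0" using w10 by simp
      then have "\<kappa> \<midarrow>0\<rightarrow> w2 0"
        by (rule Lim_transform_eventually) (auto simp: eventually_at_filter \<kappa>_def)
      then show ?thesis using True by (simp add: isCont_def \<kappa>_def)
    next
      case False
      have "isCont w1 r" using DERIV_isCont[OF w1[of r]] r by auto
      then have "isCont (\<lambda>t. w1 t / t) r" using False by (intro continuous_intros)
      moreover have "\<forall>\<^sub>F t in nhds r. t \<noteq> 0" using False by (intro t1_space_nhds)
      then have "\<forall>\<^sub>F t in nhds r. \<kappa> t = w1 t / t" by eventually_elim (simp add: \<kappa>_def)
      ultimately show ?thesis using isCont_cong by fast
    qed
  qed
  have cp: "continuous_on {-1<..<1} p" and cq: "continuous_on {-1<..<1} q"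
    unfolding p_def q_def by (intro continuous_intros cw cw1 w2 c\<kappa>; simp)+
  have pq0: "p 0 = l0" "q 0 = l0" using w10 l0 by (auto simp: p_def q_def \<kappa>_def)
  define m where "m r = 1 / r - w1 r / w r" for r
  have dq: "(q has_real_derivative (p r - q r) * m r) (at r)" if r: "0 < r" "r < 1" for r
  proof -
    have "((\<lambda>t. w t * (w1 t / t) - (w1 t)\<^sup>2 / 2) has_real_derivative (p r - q r) * m r) (at r)"
      using r pos[of r] w[of r] w1[of r]
      by (auto intro!: derivative_eq_intros simp: p_def q_def \<kappa>_def m_def field_simps power2_eq_square)
    moreover have "\<forall>\<^sub>F t in nhds r. t \<noteq> 0" using r by (intro t1_space_nhds) simp
    then have "\<forall>\<^sub>F t in nhds r. q t = w t * (w1 t / t) - (w1 t)\<^sup>2 / 2"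
      by eventually_elim (simp add: \<kappa>_def q_def)
    ultimately show ?thesis by (rule DERIV_eventually_eq)
  qed
  have wne: "w r \<noteq> 0" if "\<bar>r\<bar> < 1" for r using pos[OF that] by simp
  have cm: "continuous_on {0<..<1} m"
    unfolding m_def
    by (intro continuous_intros continuous_on_subset[OF cw] continuous_on_subset[OF cw1])
       (auto simp: wne)
  define Z where "Z = {r \<in> {0..<1}. p r = l0 \<and> q r = l0}"
  let ?good = "\<lambda>r. \<bar>p r - l0\<bar> < \<delta> \<and> \<bar>q r - l0\<bar> < \<delta>"
  have nbhd: "\<exists>\<epsilon>>0. \<forall>r. \<bar>r - s\<bar> < \<epsilon> \<longrightarrow> \<bar>r\<bar> < 1 \<and> ?good r" if s: "s \<in> Z" for s
  proof -
    have "isCont p s" "isCont q s"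
      using cp cq s by (auto simp: Z_def continuous_on_eq_continuous_at)
    then have "isCont (\<lambda>r. max \<bar>p r - l0\<bar> \<bar>q r - l0\<bar>) s" by (intro continuous_intros)
    then have "((\<lambda>r. max \<bar>p r - l0\<bar> \<bar>q r - l0\<bar>) \<longlongrightarrow> 0) (nhds s)"
      using s by (simp add: Z_def continuous_within tendsto_nhds_iff)
    then have "\<forall>\<^sub>F r in nhds s. max \<bar>p r - l0\<bar> \<bar>q r - l0\<bar> < \<delta>"
      using \<delta> by (rule order_tendstoD)
    moreover have "\<forall>\<^sub>F r in nhds s. r \<in> {-1<..<1}"
      by (rule eventually_nhds_in_open) (use s in \<open>auto simp: Z_def\<close>)
    ultimately have "\<forall>\<^sub>F r in nhds s. \<bar>r\<bar> < 1 \<and> ?good r" by eventually_elim auto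
    then show ?thesis by (simp add: eventually_nhds_metric dist_real_def)
  qed
  have Zq: "r \<in> Z" if r: "0 \<le> r" "r < 1" "?good r" "q r = l0" for r
    using level[of r] r by (auto simp: Z_def)
  have diff: "\<exists>c. 0 \<le> c \<and> c \<le> C \<and> p r - q r = - (1 + c) * (q r - l0)"
    if r: "0 \<le> r" "r < 1" "?good r" for r
    using level[of r] r by (fastforce simp: algebra_simps)
  have open0: "\<exists>e>0. \<forall>r\<in>{0..<1}. dist r 0 < e \<longrightarrow> r \<in> Z"
  proof -
    have "0 \<in> Z" using pq0 by (simp add: Z_def)
    from nbhd[OF this] obtain \<epsilon> where \<epsilon>: "\<epsilon> > 0" "\<And>r. \<bar>r\<bar> < \<epsilon> \<Longrightarrow> \<bar>r\<bar> < 1 \<and> ?good r" by auto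
    \<comment> \<open>This function is \<open>r w(r) m(r)\<close>, and its value at \<open>0\<close> is \<open>w(0) > 0\<close>; hence \<open>m > 0\<close> for small \<open>r > 0\<close>.\<close>
    have "isCont (\<lambda>r. w r - r * w1 r) 0"
      using DERIV_isCont[OF w[of 0]] DERIV_isCont[OF w1[of 0]] by (intro continuous_intros) auto
    then have "((\<lambda>r. w r - r * w1 r) \<longlongrightarrow> w 0) (nhds 0)"
      by (simp add: continuous_within tendsto_nhds_iff)
    then have "\<forall>\<^sub>F r in nhds 0. 0 < w r - r * w1 r"
      using pos[of 0] by (intro order_tendstoD) auto
    then obtain \<eta> where \<eta>: "\<eta> > 0" "\<And>r. \<bar>r\<bar> < \<eta> \<Longrightarrow> 0 < w r - r * w1 r"
      by (auto simp: eventually_nhds_metric dist_real_def)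
    have "r \<in> Z" if r: "0 \<le> r" "r < min \<epsilon> \<eta>" for r
    proof -
      have good: "\<bar>t\<bar> < 1 \<and> ?good t" if "0 \<le> t" "t \<le> r" for t
        using \<epsilon>(2)[of t] r that by auto
      have "(q r - l0)\<^sup>2 \<le> (q 0 - l0)\<^sup>2"
      proof (rule DERIV_nonpos_imp_decreasing_open[OF r(1)])
        show "continuous_on {0..r} (\<lambda>t. (q t - l0)\<^sup>2)"
          by (intro continuous_intros continuous_on_subset[OF cq]) (use good in force)
        fix t assume t: "0 < t" "t < r"
        then have t1: "t < 1" and gt: "?good t" using good[of t] by auto
        obtain c where c: "0 \<le> c" "p t - q t = - (1 + c) * (q t - l0)"
          using diff[of t] t t1 gt by auto
        have m: "0 \<le> m t"
          using \<eta>(2)[of t] t r pos[of t] t1 by (auto simp: m_def field_simps)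
        have "((\<lambda>t. (q t - l0)\<^sup>2) has_real_derivative 2 * (q t - l0) * ((p t - q t) * m t)) (at t)"
          using dq[OF t(1) t1] by (auto intro!: derivative_eq_intros)
        moreover have "2 * (q t - l0) * ((p t - q t) * m t) = - (2 * (1 + c) * m t * (q t - l0)\<^sup>2)"
          by (simp only: c(2)) (simp add: power2_eq_square algebra_simps)
        moreover have "0 \<le> 2 * (1 + c) * m t * (q t - l0)\<^sup>2" using c m by simp
        ultimately show "\<exists>y. ((\<lambda>t. (q t - l0)\<^sup>2) has_real_derivative y) (at t) \<and> y \<le> 0"
          by (metis neg_le_0_iff_le)
      qed
      then have "q r = l0" using pq0 by simp
      then show ?thesis using good[of r] r Zq by auto
    qed
    then show ?thesis using \<epsilon>(1) \<eta>(1) by (intro exI[of _ "min \<epsilon> \<eta>"]) auto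
  qed
  have openZ: "\<exists>e>0. \<forall>r\<in>{0..<1}. dist r s < e \<longrightarrow> r \<in> Z" if s: "s \<in> Z" "0 < s" for s
  proof -
    from nbhd[OF s(1)] obtain \<epsilon> where \<epsilon>: "\<epsilon> > 0" "\<And>r. \<bar>r - s\<bar> < \<epsilon> \<Longrightarrow> \<bar>r\<bar> < 1 \<and> ?good r" by auto
    have "isCont m s" using cm s by (auto simp: Z_def continuous_on_eq_continuous_at)
    then have "(m \<longlongrightarrow> m s) (nhds s)" by (simp add: continuous_within tendsto_nhds_iff)
    from order_tendstoD(2)[OF tendsto_rabs[OF this], of "\<bar>m s\<bar> + 1"]
    have "\<forall>\<^sub>F r in nhds s. \<bar>m r\<bar> < \<bar>m s\<bar> + 1" by simp
    then obtain \<eta> where \<eta>: "\<eta> > 0" "\<And>r. \<bar>r - s\<bar> < \<eta> \<Longrightarrow> \<bar>m r\<bar> < \<bar>m s\<bar> + 1"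
      by (auto simp: eventually_nhds_metric dist_real_def)
    \<comment> \<open>The bound \<open>e \<le> s\<close> keeps the interval inside \<open>r > 0\<close>, where \<open>q\<close> is differentiable.\<close>
    define e where "e = min s (min \<epsilon> \<eta>)"
    have near: "0 < t \<and> t < 1 \<and> ?good t \<and> \<bar>m t\<bar> \<le> \<bar>m s\<bar> + 1" if "s - e < t" "t < s + e" for t
    proof -
      have "e \<le> s" "e \<le> \<epsilon>" "e \<le> \<eta>" by (simp_all add: e_def)
      then have "\<bar>t - s\<bar> < s" "\<bar>t - s\<bar> < \<epsilon>" "\<bar>t - s\<bar> < \<eta>" using that by linarith+
      then show ?thesis using \<epsilon>(2)[of t] \<eta>(2)[of t] by linarith
    qed
    have e0: "0 < e" using \<epsilon> \<eta> s by (simp add: e_def)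
    have "q r - l0 = 0" if r: "s - e < r" "r < s + e" for r
    proof (rule zero_of_linear_growth_bound[where f="\<lambda>r. q r - l0" and a="s - e" and b="s + e" and s=s and K="(1 + C) * (\<bar>m s\<bar> + 1)"
          and f'="\<lambda>r. (p r - q r) * m r"])
      fix t assume t: "s - e < t" "t < s + e"
      note nt = near[OF t]
      show "((\<lambda>t. q t - l0) has_real_derivative (p t - q t) * m t) (at t)"
        using dq[of t] nt by (auto intro!: derivative_eq_intros)
      obtain c where c: "0 \<le> c" "c \<le> C" "p t - q t = - (1 + c) * (q t - l0)"
        using diff[of t] nt by auto
      have "\<bar>(p t - q t) * m t\<bar> = (1 + c) * \<bar>m t\<bar> * \<bar>q t - l0\<bar>"
        using c(1) by (simp only: c(3) abs_mult) simp
      also have "\<dots> \<le> (1 + C) * (\<bar>m s\<bar> + 1) * \<bar>q t - l0\<bar>"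
        using c nt by (intro mult_right_mono mult_mono) auto
      finally show "\<bar>(p t - q t) * m t\<bar> \<le> (1 + C) * (\<bar>m s\<bar> + 1) * \<bar>q t - l0\<bar>" .
    qed (use e0 s r in \<open>auto simp: Z_def\<close>)
    then have "r \<in> Z" if "dist r s < e" for r
      using near[of r] that by (intro Zq) (auto simp: dist_real_def abs_less_iff)
    then show ?thesis using e0 by blast
  qed
  have "openin (top_of_set {0..<1}) Z"
    unfolding openin_euclidean_subtopology_iff
  proof (intro conjI ballI)
    show "Z \<subseteq> {0..<1}" by (auto simp: Z_def)
    fix s assume "s \<in> Z"
    then have "s = 0 \<or> 0 < s" by (auto simp: Z_def)
    with open0 openZ[OF \<open>s \<in> Z\<close>]
    show "\<exists>e>0. \<forall>r\<in>{0..<1}. dist r s < e \<longrightarrow> r \<in> Z" by metis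
  qed
  moreover have "closedin (top_of_set {0..<1}) Z"
  proof -
    have "continuous_on {0..<1} (\<lambda>r. (p r, q r))"
      by (intro continuous_on_Pair continuous_on_subset[OF cp] continuous_on_subset[OF cq]) auto
    from continuous_closedin_preimage_constant[OF this, of "(l0, l0)"] show ?thesis
      by (simp add: Z_def)
  qed
  ultimately have "Z = {} \<or> Z = {0..<1}"
    using connected_clopen[of "{0..<1::real}"] convex_connected[OF convex_real_interval(7)] by blast
  moreover have "0 \<in> Z" using pq0 by (simp add: Z_def)
  ultimately have Z: "Z = {0..<1}" by blast
  \<comment> \<open>Equality of the two eigenvalues means \<open>w'' = w'/r\<close>, that is, \<open>(w'/r)' = 0\<close>.\<close>
  have w2eq: "w2 r = w1 r / r" if "0 < r" "r < 1" for r
  proof -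
    have "r \<in> Z" using Z that by simp
    then have "p r = l0" "q r = l0" by (simp_all add: Z_def)
    then have "w r * w2 r = w r * (w1 r / r)" using that by (simp add: p_def q_def \<kappa>_def)
    moreover have "w r \<noteq> 0" using wne[of r] that by simp
    ultimately show ?thesis by (metis mult_left_cancel)
  qed
  have \<kappa>const: "\<kappa> r = w2 0" if r: "0 < r" "r < 1" for r
  proof -
    have "\<kappa> r = \<kappa> 0"
    proof (rule DERIV_isconst2[of 0 r])
      show "continuous_on {0..r} \<kappa>" by (rule continuous_on_subset[OF c\<kappa>]) (use r in auto)
      fix t assume t: "0 < t" "t < r"
      have "((\<lambda>t. w1 t / t) has_real_derivative 0) (at t)"
        using t r w1[of t] w2eq[of t] by (auto intro!: derivative_eq_intros simp: field_simps)
      moreover have "\<forall>\<^sub>F s in nhds t. s \<noteq> 0" using t by (intro t1_space_nhds) simp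
      then have "\<forall>\<^sub>F s in nhds t. \<kappa> s = w1 s / s" by eventually_elim (simp add: \<kappa>_def)
      ultimately show "(\<kappa> has_real_derivative 0) (at t)" by (rule DERIV_eventually_eq)
    qed (use r in auto)
    then show ?thesis by (simp add: \<kappa>_def)
  qed
  show thesis
  proof
    show "l0 = 2 * w 0 * (w2 0 / 2)" using l0 by simp
    fix r :: real assume r: "0 \<le> r" "r < 1"
    show "w r = w 0 + w2 0 / 2 * r\<^sup>2"
    proof (cases "r = 0")
      case False
      have "w r - w2 0 / 2 * r\<^sup>2 = w 0 - w2 0 / 2 * 0\<^sup>2"
      proof (rule DERIV_isconst2[of 0 r])
        show "continuous_on {0..r} (\<lambda>t. w t - w2 0 / 2 * t\<^sup>2)"
          by (intro continuous_intros continuous_on_subset[OF cw]) (use r in auto)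
        fix t assume t: "0 < t" "t < r"
        have "w1 t = w2 0 * t" using \<kappa>const[of t] t r by (simp add: \<kappa>_def field_simps)
        then show "((\<lambda>t. w t - w2 0 / 2 * t\<^sup>2) has_real_derivative 0) (at t)"
          using w[of t] t r by (auto intro!: derivative_eq_intros)
      qed (use r False in auto)
      then show ?thesis by simp
    qed simp
  qed
qed

section \<open>Classification of radial solutions\<close>

theorem theorem1p6:
  fixes U :: "(real^'n^'n) set"
    and F :: "real^'n^'n \<Rightarrow> real"
    and u :: "real^'n \<Rightarrow> real"
  assumes n3: "CARD('n) \<ge> 3"
    and U_open: "openin (top_of_set sym_matrices) U"
    and U_inv: "\<And>Q :: real^'n^'n. orthogonal_matrix Q \<Longrightarrow> (\<lambda>M. matrix_inv Q ** M ** Q) ` U = U"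
    and F_C1: "C1_on sym_matrices U F"
    and F_inv: "\<And>M Q. M \<in> U \<Longrightarrow> orthogonal_matrix Q \<Longrightarrow> F (matrix_inv Q ** M ** Q) = F M"
    and F_elliptic: "\<And>M. M \<in> U \<Longrightarrow> positive_definite (matrix_gradient F M)"
    and u_C2: "C2_on UNIV (ball 0 1) u"
    and u_radial: "radially_symmetric_on (ball 0 1) u"
    and u_eq: "\<And>x. x \<in> ball 0 1 \<Longrightarrow> F (conf_hessian u x) = 1"
    and u_adm: "\<And>x. x \<in> ball 0 1 \<Longrightarrow> conf_hessian u x \<in> U"
    and u_pos: "\<And>x. x \<in> ball 0 1 \<Longrightarrow> u x > 0"
  shows "\<exists>a b :: real. a > 0 \<and> b \<ge> -1
           \<and> (\<forall>x \<in> ball 0 1. u x = (a / (1 + b * (norm x)\<^sup>2)) powr ((real CARD('n) - 2) / 2))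
           \<and> (2 * b / a\<^sup>2) *\<^sub>R mat 1 \<in> U
           \<and> F ((2 * b / a\<^sup>2) *\<^sub>R mat 1) = 1"
proof -
  define \<alpha> where "\<alpha> = 2 / (real CARD('n) - 2)"
  have \<alpha>n: "\<alpha> * ((real CARD('n) - 2) / 2) = 1"
  proof -
    have "real CARD('n) - 2 \<noteq> 0" using n3 by linarith
    then show ?thesis by (simp add: \<alpha>_def)
  qed
  obtain k :: 'n where True by simp
  from radial_C2_profile[OF u_C2 u_radial, of k]
  obtain v v1 v2 where uv: "\<And>x. x \<in> ball 0 1 \<Longrightarrow> u x = v (norm x)"
    and vu: "\<And>r. v r = u (r *\<^sub>R axis k 1)"
    and dv: "\<And>r. \<bar>r\<bar> < 1 \<Longrightarrow> (v has_real_derivative v1 r) (at r)"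
    and dv1: "\<And>r. \<bar>r\<bar> < 1 \<Longrightarrow> (v1 has_real_derivative v2 r) (at r)"
    and cv2: "continuous_on {-1<..<1} v2" and v10: "v1 0 = 0"
    and grad: "\<And>r. 0 \<le> r \<Longrightarrow> r < 1 \<Longrightarrow> grad u (r *\<^sub>R axis k 1) = v1 r *\<^sub>R axis k 1"
    and hess: "\<And>r. 0 \<le> r \<Longrightarrow> r < 1 \<Longrightarrow> hessian u (r *\<^sub>R axis k 1)
        = radial_matrix k (v2 r) (if r = 0 then v2 0 else v1 r / r)"
    by blast
  have vpos: "0 < v r" if "\<bar>r\<bar> < 1" for r
    unfolding vu using that by (intro u_pos) simp
  define w where "w r = v r powr - \<alpha>" for r
  define w1 where "w1 r = - \<alpha> * v r powr (- \<alpha> - 1) * v1 r" for r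
  define w2 where "w2 r = - \<alpha> * v r powr (- \<alpha> - 1) * v2 r
    + \<alpha> * (\<alpha> + 1) * v r powr (- \<alpha> - 2) * (v1 r)\<^sup>2" for r
  have dpow: "((\<lambda>r. v r powr a) has_real_derivative a * v r powr (a - 1) * v1 r) (at r)"
    if "\<bar>r\<bar> < 1" for r a
    by (rule DERIV_chain2[OF has_real_derivative_powr[OF vpos[OF that]] dv[OF that]])
  have dw: "(w has_real_derivative w1 r) (at r)" if "\<bar>r\<bar> < 1" for r
    using dpow[OF that, of "- \<alpha>"] by (simp add: w_def[abs_def] w1_def)
  have dw1: "(w1 has_real_derivative w2 r) (at r)" if r: "\<bar>r\<bar> < 1" for r
  proof -
    have "((\<lambda>r. - \<alpha> * (v r powr (- \<alpha> - 1) * v1 r)) has_real_derivative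
        - \<alpha> * ((- \<alpha> - 1) * v r powr (- \<alpha> - 1 - 1) * v1 r * v1 r + v2 r * v r powr (- \<alpha> - 1))) (at r)"
      by (intro DERIV_cmult DERIV_mult dpow dv1 r)
    moreover have "- \<alpha> * ((- \<alpha> - 1) * v r powr (- \<alpha> - 1 - 1) * v1 r * v1 r
        + v2 r * v r powr (- \<alpha> - 1)) = w2 r"
    proof -
      have e: "- \<alpha> - 1 - 1 = - \<alpha> - 2" by simp
      show ?thesis unfolding w2_def e power2_eq_square by (simp add: algebra_simps)
    qed
    moreover have "(\<lambda>r. - \<alpha> * (v r powr (- \<alpha> - 1) * v1 r)) = w1"
      by (simp add: w1_def fun_eq_iff)
    ultimately show ?thesis by simp
  qed
  have cw2: "continuous_on {-1<..<1} w2"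
  proof -
    have cv: "continuous_on {-1<..<1} v" "continuous_on {-1<..<1} v1"
      by (intro continuous_at_imp_continuous_on ballI; rule DERIV_isCont[OF dv] DERIV_isCont[OF dv1]; force)+
    have "v r \<noteq> 0" if "\<bar>r\<bar> < 1" for r using vpos[OF that] by simp
    then show ?thesis
      unfolding w2_def[abs_def]
      by (intro continuous_intros cv cv2) auto
  qed
  have wpos: "0 < w r" if "\<bar>r\<bar> < 1" for r using vpos[OF that] by (simp add: w_def)
  have w10: "w1 0 = 0" by (simp add: w1_def v10)
  define \<kappa> where "\<kappa> r = (if r = 0 then w2 0 else w1 r / r)" for r
  define p where "p r = w r * w2 r - (w1 r)\<^sup>2 / 2" for r
  define q where "q r = w r * \<kappa> r - (w1 r)\<^sup>2 / 2" for r
  have A: "conf_hessian u (r *\<^sub>R axis k 1) = radial_matrix k (p r) (q r)"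
    if r: "0 \<le> r" "r < 1" for r
  proof -
    note A = conf_hessian_radial_matrix[OF n3 grad[OF r] hess[OF r]]
    have \<kappa>: "- \<alpha> * v r powr (- \<alpha> - 1) * (if r = 0 then v2 0 else v1 r / r) = \<kappa> r"
      by (simp add: \<kappa>_def w1_def w2_def v10)
    show ?thesis
      using A unfolding p_def q_def \<kappa>[symmetric] w_def w1_def w2_def Let_def \<alpha>_def[symmetric] vu[symmetric] .
  qed
  define l0 where "l0 = w 0 * w2 0"
  have inB: "r *\<^sub>R axis k 1 \<in> ball (0::real^'n) 1" if "0 \<le> r" "r < 1" for r using that by simp
  have p0: "p 0 = l0" "q 0 = l0" by (simp_all add: p_def q_def \<kappa>_def l0_def w10)
  have U0: "radial_matrix k l0 l0 \<in> U" and F0: "F (radial_matrix k l0 l0) = 1"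
    using u_adm[OF inB[of 0]] u_eq[OF inB[of 0]] A[of 0] p0 by simp_all
  obtain \<delta> C where \<delta>: "0 < \<delta>" and level: "\<And>p q. \<bar>p - l0\<bar> < \<delta> \<Longrightarrow> \<bar>q - l0\<bar> < \<delta> \<Longrightarrow>
      F (radial_matrix k p q) = F (radial_matrix k l0 l0) \<Longrightarrow>
      \<exists>c. 0 \<le> c \<and> c \<le> C \<and> p - l0 = - c * (q - l0)"
    using radial_level_set[OF U_open F_C1 F_elliptic U0] by blast
  obtain \<beta> where \<beta>: "\<And>r. 0 \<le> r \<Longrightarrow> r < 1 \<Longrightarrow> w r = w 0 + \<beta> * r\<^sup>2" "l0 = 2 * w 0 * \<beta>"
  proof (rule radial_ode_rigidity[OF dw dw1 cw2 wpos w10 l0_def \<delta>])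
    fix r :: real
    assume r: "0 \<le> r" "r < 1"
      and "\<bar>w r * w2 r - (w1 r)\<^sup>2 / 2 - l0\<bar> < \<delta>"
        "\<bar>w r * (if r = 0 then w2 0 else w1 r / r) - (w1 r)\<^sup>2 / 2 - l0\<bar> < \<delta>"
    then have "\<bar>p r - l0\<bar> < \<delta>" "\<bar>q r - l0\<bar> < \<delta>" by (simp_all only: p_def q_def \<kappa>_def)
    moreover have "F (radial_matrix k (p r) (q r)) = F (radial_matrix k l0 l0)"
      using u_eq[OF inB[OF r]] A[OF r] F0 by simp
    ultimately show "\<exists>c. 0 \<le> c \<and> c \<le> C \<and> w r * w2 r - (w1 r)\<^sup>2 / 2 - l0 =
        - c * (w r * (if r = 0 then w2 0 else w1 r / r) - (w1 r)\<^sup>2 / 2 - l0)"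
      using level by (simp only: p_def q_def \<kappa>_def)
  qed (assumption+, rule that)
  define a where "a = 1 / w 0"
  define b where "b = \<beta> / w 0"
  have w0: "0 < w 0" by (rule wpos) simp
  have wab: "w r = (1 + b * r\<^sup>2) / a" if "0 \<le> r" "r < 1" for r
    using \<beta>(1)[OF that] w0 by (simp add: a_def b_def field_simps)
  have a0: "0 < a" using w0 by (simp add: a_def)
  have b1: "b \<ge> - 1"
  proof (rule ccontr)
    assume "\<not> b \<ge> - 1"
    then have "b < - 1" by simp
    \<comment> \<open>At this radius the quadratic \<open>1 + b r\<^sup>2\<close> vanishes.\<close>
    define r where "r = sqrt (1 / (- b))"
    have "1 / (- b) < 1"
      using divide_less_eq_1_pos[of "- b" 1] \<open>b < - 1\<close> by simp
    then have r: "0 \<le> r" "r < 1"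
      unfolding r_def real_sqrt_lt_1_iff using \<open>b < - 1\<close> by auto
    have "r\<^sup>2 = 1 / (- b)" using \<open>b < - 1\<close> by (simp add: r_def)
    then have "w r = 0" using wab[OF r] \<open>b < - 1\<close> by simp
    then show False using wpos[of r] r by simp
  qed
  have l: "2 * b / a\<^sup>2 = l0" using \<beta>(2) w0 by (simp add: a_def b_def field_simps power2_eq_square)
  have "l0 *\<^sub>R mat 1 = radial_matrix k l0 l0"
    by (simp add: radial_matrix_def mat_def vec_eq_iff)
  then have UF: "(2 * b / a\<^sup>2) *\<^sub>R mat 1 \<in> U" "F ((2 * b / a\<^sup>2) *\<^sub>R mat 1) = 1"
    using U0 F0 l by simp_all
  have "u x = (a / (1 + b * (norm x)\<^sup>2)) powr ((real CARD('n) - 2) / 2)" if x: "x \<in> ball 0 1" for x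
  proof -
    have r: "0 \<le> norm x" "norm x < 1" using x by auto
    have "(a / (1 + b * (norm x)\<^sup>2)) = 1 / w (norm x)" using wab[OF r] by simp
    also have "\<dots> = v (norm x) powr \<alpha>" by (simp add: w_def powr_minus_divide)
    also have "\<dots> powr ((real CARD('n) - 2) / 2) = v (norm x)"
      using vpos[of "norm x"] r \<alpha>n by (simp add: powr_powr)
    finally show ?thesis using uv[OF x] by simp
  qed
  with a0 b1 UF show ?thesis by blast
qed

end
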